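(* Let $\alpha\ge 2$. If the problem 2TRG Winning Set of order $n\times n$ can be solved in $O(n^\alpha)$ time, then Boolean Matrix Multiplication of size $n\times n\times n$ can be computed in $O(n^\alpha)$ time.
   Context: A game-graph is $\mathcal G=(\mathcal V,\mathcal E,\mathcal V^0,\mathcal V^1)$: a finite set $\mathcal V$ of configurations, moves $\mathcal E\subseteq\mathcal V\times\mathcal V$, and a partition $(\mathcal V^0,\mathcal V^1)$ of $\mathcal V$ into configurations controlled by player 0 and player 1. A play is a non-empty finite or infinite walk in $(\mathcal V,\mathcal E)$. A strategy for player $P$ is a map $s\colon\mathcal V^P\to\mathcal V\cup\{\bot\}$ with $(\sigma,s(\sigma))\in\mathcal E$ or $s(\sigma)=\bot$; a play conforms to $s$ if at each $\sigma_i\in\mathcal V^P$ either $\sigma_{i+1}=s(\sigma_i)\neq\bot$ or $s(\sigma_i)=\bot$ and $\sigma_i$ is last. A reachability game is $(\mathcal G,\mathcal F)$ with $\mathcal F=(\mathcal F^0,\mathcal F^1)$ a partition of $\mathcal V$. A play is winning for $P$ if it is finite with last configuration in $\mathcal F^P$, surviving for $P$ if winning for $P$ or infinite. The winning set $\mathcal W^P$ (resp. surviving set $\mathcal S^P$) is the set of configurations $\sigma_0$ from which $P$ has a strategy such that every conforming play starting at $\sigma_0$ is winning (resp. surviving) for $P$. For finite directed graphs $G_0=(V_0,E_0)$, $G_1=(V_1,E_1)$, the two-tokens game-graph $\mathcal G(G_0,G_1)$ has configurations $\mathcal V^P=\{\langle P,u,v\rangle:u\in V_P,v\in V_{1-P}\}$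 and moves $(\langle P,u,v\rangle,\langle1-P,v,u'\rangle)$ for $(u,u')\in E_P$, $v\in V_{1-P}$. The problem 2TRG Winning Set of order $|V_0|\times|V_1|$: given $G_0,G_1$ and a partition $\mathcal F$ of the configurations, compute the winning and surviving sets of the reachability game $(\mathcal G(G_0,G_1),\mathcal F)$. Boolean Matrix Multiplication of size $n_1\times n_2\times n_3$: given boolean matrices $\mathbf B_1$ ($n_1\times n_2$) and $\mathbf B_2$ ($n_2\times n_3$), compute $(\mathbf B_1\star\mathbf B_2)[i,j]=\bigvee_{k=1}^{n_2}\mathbf B_1[i,k]\wedge\mathbf B_2[k,j]$. *)

theory Defs
  imports
    "HOL-Library.Landau_Symbols"
    "Graph_Theory.Pair_Digraph"
    "Jordan_Normal_Form.Matrix"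
begin

section \<open>Reachability games\<close>

datatype player = P0 | P1

fun opponent :: "player \<Rightarrow> player" where
  "opponent P0 = P1"
| "opponent P1 = P0"

record 'c game_graph =
  configs :: "'c set"
  moves :: "('c \<times> 'c) set"
  controlled :: "player \<Rightarrow> 'c set"

text \<open>Blocks of a partition indexed by the two players may be empty.\<close>

definition player_partition :: "'c set \<Rightarrow> (player \<Rightarrow> 'c set) \<Rightarrow> bool" where
  "player_partition A B \<longleftrightarrow> B P0 \<union> B P1 = A \<and> B P0 \<inter> B P1 = {}"

definition is_game_graph :: "'c game_graph \<Rightarrow> bool" where
  "is_game_graph G \<longleftrightarrow>
     finite (configs G) \<and> moves G \<subseteq> configs G \<times> configs G \<and>
     player_partition (configs G) (controlled G)"

datatype 'c play = Fin "'c list" | Inf "nat \<Rightarrow> 'c"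

fun is_play :: "'c game_graph \<Rightarrow> 'c play \<Rightarrow> bool" where
  "is_play G (Fin xs) \<longleftrightarrow>
     xs \<noteq> [] \<and> set xs \<subseteq> configs G \<and>
     (\<forall>i. Suc i < length xs \<longrightarrow> (xs ! i, xs ! Suc i) \<in> moves G)"
| "is_play G (Inf f) \<longleftrightarrow>
     (\<forall>i. f i \<in> configs G \<and> (f i, f (Suc i)) \<in> moves G)"

fun play_start :: "'c play \<Rightarrow> 'c" where
  "play_start (Fin xs) = hd xs"
| "play_start (Inf f) = f 0"

text \<open>
  The value \<^const>\<open>None\<close> stands for the decision to stop (written bottom on paper).
  Values of a strategy outside the configurations of its player are irrelevant.
\<close>

definition is_strategy :: "'c game_graph \<Rightarrow> player \<Rightarrow> ('c \<Rightarrow> 'c option) \<Rightarrow> bool" where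
  "is_strategy G P s \<longleftrightarrow>
     (\<forall>\<sigma> \<in> controlled G P. s \<sigma> = None \<or> (\<exists>\<tau>. s \<sigma> = Some \<tau> \<and> (\<sigma>, \<tau>) \<in> moves G))"

text \<open>
  The opponent is unconstrained: a conforming play may end at any configuration
  of the opponent, whether or not a move is available there.
\<close>

fun conforms :: "'c game_graph \<Rightarrow> player \<Rightarrow> ('c \<Rightarrow> 'c option) \<Rightarrow> 'c play \<Rightarrow> bool" where
  "conforms G P s (Fin xs) \<longleftrightarrow>
     (\<forall>i < length xs. xs ! i \<in> controlled G P \<longrightarrow>
        (Suc i < length xs \<and> s (xs ! i) = Some (xs ! Suc i)) \<or>
        (Suc i = length xs \<and> s (xs ! i) = None))"
| "conforms G P s (Inf f) \<longleftrightarrow>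
     (\<forall>i. f i \<in> controlled G P \<longrightarrow> s (f i) = Some (f (Suc i)))"

fun winning_play :: "(player \<Rightarrow> 'c set) \<Rightarrow> player \<Rightarrow> 'c play \<Rightarrow> bool" where
  "winning_play F P (Fin xs) \<longleftrightarrow> last xs \<in> F P"
| "winning_play F P (Inf f) \<longleftrightarrow> False"

fun surviving_play :: "(player \<Rightarrow> 'c set) \<Rightarrow> player \<Rightarrow> 'c play \<Rightarrow> bool" where
  "surviving_play F P (Fin xs) \<longleftrightarrow> winning_play F P (Fin xs)"
| "surviving_play F P (Inf f) \<longleftrightarrow> True"

definition winning_set :: "'c game_graph \<Rightarrow> (player \<Rightarrow> 'c set) \<Rightarrow> player \<Rightarrow> 'c set" where
  "winning_set G F P =
     {\<sigma> \<in> configs G. \<exists>s. is_strategy G P s \<and>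
        (\<forall>\<pi>. is_play G \<pi> \<and> play_start \<pi> = \<sigma> \<and> conforms G P s \<pi> \<longrightarrow> winning_play F P \<pi>)}"

definition surviving_set :: "'c game_graph \<Rightarrow> (player \<Rightarrow> 'c set) \<Rightarrow> player \<Rightarrow> 'c set" where
  "surviving_set G F P =
     {\<sigma> \<in> configs G. \<exists>s. is_strategy G P s \<and>
        (\<forall>\<pi>. is_play G \<pi> \<and> play_start \<pi> = \<sigma> \<and> conforms G P s \<pi> \<longrightarrow> surviving_play F P \<pi>)}"


section \<open>Two-tokens game-graphs\<close>

type_synonym 'v config = "player \<times> 'v \<times> 'v"

fun for_player :: "player \<Rightarrow> 'a \<Rightarrow> 'a \<Rightarrow> 'a" where
  "for_player P0 a0 a1 = a0"
| "for_player P1 a0 a1 = a1"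

definition two_tokens_configs ::
  "'v pair_pre_digraph \<Rightarrow> 'v pair_pre_digraph \<Rightarrow> player \<Rightarrow> 'v config set" where
  "two_tokens_configs G0 G1 P =
     {(P, u, v) | u v. u \<in> pverts (for_player P G0 G1) \<and>
                       v \<in> pverts (for_player (opponent P) G0 G1)}"

definition two_tokens ::
  "'v pair_pre_digraph \<Rightarrow> 'v pair_pre_digraph \<Rightarrow> 'v config game_graph" where
  "two_tokens G0 G1 =
     \<lparr> configs = two_tokens_configs G0 G1 P0 \<union> two_tokens_configs G0 G1 P1,
       moves = {((P, u, v), (opponent P, v, u')) | P u v u'.
                  (u, u') \<in> parcs (for_player P G0 G1) \<and>
                  v \<in> pverts (for_player (opponent P) G0 G1)},
       controlled = two_tokens_configs G0 G1 \<rparr>"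

lemma is_game_graph_two_tokens:
  assumes "pair_fin_digraph G0" "pair_fin_digraph G1"
  shows "is_game_graph (two_tokens G0 G1)"
proof -
  interpret G0: pair_fin_digraph G0 by fact
  interpret G1: pair_fin_digraph G1 by fact
  have eq: "two_tokens_configs G0 G1 P0 = {P0} \<times> pverts G0 \<times> pverts G1"
    "two_tokens_configs G0 G1 P1 = {P1} \<times> pverts G1 \<times> pverts G0"
    by (auto simp: two_tokens_configs_def)
  have "((P, u, v), (opponent P, v, u')) \<in> configs (two_tokens G0 G1) \<times> configs (two_tokens G0 G1)"
    if "(u, u') \<in> parcs (for_player P G0 G1)" "v \<in> pverts (for_player (opponent P) G0 G1)"
    for P u v u'
    using that by (cases P)
      (auto simp: two_tokens_def eq dest: G0.wellformed' G1.wellformed')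
  then have "moves (two_tokens G0 G1) \<subseteq> configs (two_tokens G0 G1) \<times> configs (two_tokens G0 G1)"
    unfolding two_tokens_def game_graph.simps by blast
  moreover have "finite (configs (two_tokens G0 G1))"
    by (simp add: two_tokens_def eq)
  moreover have "player_partition (configs (two_tokens G0 G1)) (controlled (two_tokens G0 G1))"
    by (auto simp: two_tokens_def player_partition_def eq)
  ultimately show ?thesis by (simp add: is_game_graph_def)
qed


section \<open>Random access machines\<close>

text \<open>
  Unit-cost RAM with registers (addressed directly) and a main memory (addressed
  through registers). Cells hold natural numbers; the restriction to machine words
  is imposed on runs, see below. Control leaves the program by a jump (or by falling
  through) to an address beyond its last instruction; this is how a run halts.
\<close>

datatype arith_op =
  OpAdd | OpSub | OpMul | OpDiv | OpMod | OpAnd | OpOr | OpXor | OpShl | OpShr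

fun arith :: "arith_op \<Rightarrow> nat \<Rightarrow> nat \<Rightarrow> nat" where
  "arith OpAdd x y = x + y"
| "arith OpSub x y = x - y"
| "arith OpMul x y = x * y"
| "arith OpDiv x y = x div y"
| "arith OpMod x y = x mod y"
| "arith OpAnd x y = Bit_Operations.and x y"
| "arith OpOr x y = Bit_Operations.or x y"
| "arith OpXor x y = Bit_Operations.xor x y"
| "arith OpShl x y = push_bit y x"
| "arith OpShr x y = drop_bit y x"

datatype instr =
  Const nat nat
| Arith arith_op nat nat nat
| Load nat nat
| Store nat nat
| Jump nat
| JumpZero nat nat

type_synonym program = "instr list"

record ram_state =
  pc :: nat
  reg :: "nat \<Rightarrow> nat"
  mem :: "nat \<Rightarrow> nat"

fun exec :: "instr \<Rightarrow> ram_state \<Rightarrow> ram_state" where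
  "exec (Const r c) s = s\<lparr> pc := Suc (pc s), reg := (reg s)(r := c) \<rparr>"
| "exec (Arith f r r1 r2) s =
     s\<lparr> pc := Suc (pc s), reg := (reg s)(r := arith f (reg s r1) (reg s r2)) \<rparr>"
| "exec (Load r ra) s = s\<lparr> pc := Suc (pc s), reg := (reg s)(r := mem s (reg s ra)) \<rparr>"
| "exec (Store ra r) s = s\<lparr> pc := Suc (pc s), mem := (mem s)(reg s ra := reg s r) \<rparr>"
| "exec (Jump l) s = s\<lparr> pc := l \<rparr>"
| "exec (JumpZero r l) s = s\<lparr> pc := (if reg s r = 0 then l else Suc (pc s)) \<rparr>"

definition halted :: "program \<Rightarrow> ram_state \<Rightarrow> bool" where
  "halted p s \<longleftrightarrow> length p \<le> pc s"

definition ram_step :: "program \<Rightarrow> ram_state \<Rightarrow> ram_state" where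
  "ram_step p s = (if halted p s then s else exec (p ! pc s) s)"

definition ram_run :: "program \<Rightarrow> nat \<Rightarrow> ram_state \<Rightarrow> ram_state" where
  "ram_run p t s = (ram_step p ^^ t) s"

definition fits_words :: "nat \<Rightarrow> ram_state \<Rightarrow> bool" where
  "fits_words w s \<longleftrightarrow> (\<forall>r. reg s r < 2 ^ w) \<and> (\<forall>a. mem s a < 2 ^ w)"

text \<open>Initially, cells that do not belong to the input are zero.\<close>

definition cells_of_list :: "nat list \<Rightarrow> nat \<Rightarrow> nat" where
  "cells_of_list xs a = (if a < length xs then xs ! a else 0)"

definition initial_state :: "nat list \<Rightarrow> nat list \<Rightarrow> ram_state" where
  "initial_state rs xs = \<lparr> pc = 0, reg = cells_of_list rs, mem = cells_of_list xs \<rparr>"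

text \<open>
  On size parameters \<open>rs\<close> (in registers) and input \<open>xs\<close> (in memory), the program halts
  within \<open>t\<close> steps with the output \<open>ys\<close> at the beginning of memory, and no cell ever
  holds a number of more than \<open>w\<close> bits.
\<close>

definition computes_within ::
  "program \<Rightarrow> nat list \<Rightarrow> nat list \<Rightarrow> nat list \<Rightarrow> nat \<Rightarrow> nat \<Rightarrow> bool" where
  "computes_within p rs xs ys t w \<longleftrightarrow>
     halted p (ram_run p t (initial_state rs xs)) \<and>
     map (mem (ram_run p t (initial_state rs xs))) [0..<length ys] = ys \<and>
     (\<forall>i \<le> t. fits_words w (ram_run p i (initial_state rs xs)))"


section \<open>Computational problems\<close>

text \<open>A problem of a fixed size, with its input and output representations.\<close>

record 'i problem =
  size_params :: "nat list"
  instances :: "'i set"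
  input :: "'i \<Rightarrow> nat list"
  solution :: "'i \<Rightarrow> nat list"

text \<open>
  One program for all sizes, with worst-case running time in \<open>O(f)\<close>, on words of
  logarithmically many bits.
\<close>

definition solvable_in_time :: "(nat \<Rightarrow> 'i problem) \<Rightarrow> (nat \<Rightarrow> real) \<Rightarrow> bool" where
  "solvable_in_time A f \<longleftrightarrow>
     (\<exists>(p :: program) (T :: nat \<Rightarrow> nat) (W :: nat \<Rightarrow> nat).
        (\<lambda>n. real (T n)) \<in> O(f) \<and>
        (\<lambda>n. real (W n)) \<in> O(\<lambda>n. ln (real n)) \<and>
        (\<forall>n. \<forall>x \<in> instances (A n).
           computes_within p (size_params (A n)) (input (A n) x) (solution (A n) x) (T n) (W n)))"

definition relation_bits :: "nat \<Rightarrow> nat \<Rightarrow> (nat \<Rightarrow> nat \<Rightarrow> bool) \<Rightarrow> nat list" where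
  "relation_bits n m R = concat (map (\<lambda>i. map (\<lambda>j. of_bool (R i j)) [0..<m]) [0..<n])"

text \<open>
  Vertex sets are initial segments of the natural numbers, graphs are given by
  adjacency matrices, and a set of configurations by two bit matrices, one for the
  configurations of each player. The partition is given by its block of player 0.
\<close>

definition graph_bits :: "nat \<Rightarrow> nat pair_pre_digraph \<Rightarrow> nat list" where
  "graph_bits n G = relation_bits n n (\<lambda>u v. (u, v) \<in> parcs G)"

definition config_set_bits :: "nat \<Rightarrow> nat \<Rightarrow> nat config set \<Rightarrow> nat list" where
  "config_set_bits n0 n1 C =
     relation_bits n0 n1 (\<lambda>u v. (P0, u, v) \<in> C) @ relation_bits n1 n0 (\<lambda>u v. (P1, u, v) \<in> C)"

type_synonym two_tokens_instance =
  "nat pair_pre_digraph \<times> nat pair_pre_digraph \<times> (player \<Rightarrow> nat config set)"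

definition two_trg_winning_set :: "nat \<Rightarrow> nat \<Rightarrow> two_tokens_instance problem" where
  "two_trg_winning_set n0 n1 =
     \<lparr> size_params = [n0, n1],
       instances = {(G0, G1, F).
         pair_fin_digraph G0 \<and> pverts G0 = {0..<n0} \<and>
         pair_fin_digraph G1 \<and> pverts G1 = {0..<n1} \<and>
         player_partition (configs (two_tokens G0 G1)) F},
       input = (\<lambda>(G0, G1, F).
         graph_bits n0 G0 @ graph_bits n1 G1 @ config_set_bits n0 n1 (F P0)),
       solution = (\<lambda>(G0, G1, F).
         config_set_bits n0 n1 (winning_set (two_tokens G0 G1) F P0) @
         config_set_bits n0 n1 (winning_set (two_tokens G0 G1) F P1) @
         config_set_bits n0 n1 (surviving_set (two_tokens G0 G1) F P0) @
         config_set_bits n0 n1 (surviving_set (two_tokens G0 G1) F P1)) \<rparr>"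

definition bool_mat_mult :: "bool mat \<Rightarrow> bool mat \<Rightarrow> bool mat" (infixl "\<star>" 70) where
  "B1 \<star> B2 =
     mat (dim_row B1) (dim_col B2) (\<lambda>(i, j). \<exists>k < dim_col B1. B1 $$ (i, k) \<and> B2 $$ (k, j))"

definition mat_bits :: "bool mat \<Rightarrow> nat list" where
  "mat_bits B = relation_bits (dim_row B) (dim_col B) (\<lambda>i j. B $$ (i, j))"

definition boolean_matrix_multiplication ::
  "nat \<Rightarrow> nat \<Rightarrow> nat \<Rightarrow> (bool mat \<times> bool mat) problem" where
  "boolean_matrix_multiplication n1 n2 n3 =
     \<lparr> size_params = [n1, n2, n3],
       instances = carrier_mat n1 n2 \<times> carrier_mat n2 n3,
       input = (\<lambda>(B1, B2). mat_bits B1 @ mat_bits B2),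
       solution = (\<lambda>(B1, B2). mat_bits (B1 \<star> B2)) \<rparr>"

end

theory Submission
  imports Defs
begin

text \<open>
  Let the arcs of \<open>G0\<close> be given by \<open>B1\<close>, let \<open>G1\<close> have no arcs, and let player 0 win exactly
  in the configurations \<open>(P1, j, k)\<close> with \<open>B2 $$ (k, j)\<close>. From \<open>(P0, i, j)\<close> player 0 loses by
  stopping, and a move to \<open>(P1, j, k)\<close> ends the play, so that \<open>(P0, i, j)\<close> is winning for
  player 0 if and only if \<open>(B1 \<star> B2) $$ (i, j)\<close>. In memory this instance differs from the
  input of the matrix multiplication only in that \<open>B2\<close> is moved and transposed, which takes
  quadratic time, and the bits of the product are already the first block of the solution.
\<close>

section \<open>The game of a matrix product\<close>

text \<open>The bounds keep every arc inside the vertex set, whatever the dimensions of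
  \<open>B\<close>.\<close>

definition product_graph :: "nat \<Rightarrow> bool mat \<Rightarrow> nat pair_pre_digraph" where
  "product_graph n B = \<lparr> pverts = {0..<n}, parcs = {(i, k). i < n \<and> k < n \<and> B $$ (i, k)} \<rparr>"

definition arcless_graph :: "nat \<Rightarrow> nat pair_pre_digraph" where
  "arcless_graph n = \<lparr> pverts = {0..<n}, parcs = {} \<rparr>"

text \<open>A move swaps the places of the two vertices: \<open>(P0, i, j)\<close> leads to
  \<open>(P1, j, k)\<close>. Hence \<open>B2\<close> is read with its indices exchanged.\<close>

fun product_goal :: "nat \<Rightarrow> bool mat \<Rightarrow> bool mat \<Rightarrow> player \<Rightarrow> nat config set" where
  "product_goal n B1 B2 P0 = {(P1, j, k) | j k. j < n \<and> k < n \<and> B2 $$ (k, j)}"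
| "product_goal n B1 B2 P1 =
     configs (two_tokens (product_graph n B1) (arcless_graph n)) -
     {(P1, j, k) | j k. j < n \<and> k < n \<and> B2 $$ (k, j)}"

definition product_instance :: "nat \<Rightarrow> bool mat \<Rightarrow> bool mat \<Rightarrow> two_tokens_instance" where
  "product_instance n B1 B2 = (product_graph n B1, arcless_graph n, product_goal n B1 B2)"

lemma product_instance_in_instances:
  "product_instance n B1 B2 \<in> instances (two_trg_winning_set n n)"
proof -
  have "parcs (product_graph n B1) \<subseteq> {0..<n} \<times> {0..<n}" by (auto simp: product_graph_def)
  then have "finite (parcs (product_graph n B1))" by (rule finite_subset) simp
  then have graphs: "pair_fin_digraph (product_graph n B1)" "pair_fin_digraph (arcless_graph n)"
    by (unfold_locales; auto simp: product_graph_def arcless_graph_def)+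
  have "product_goal n B1 B2 P0 \<subseteq> configs (two_tokens (product_graph n B1) (arcless_graph n))"
    by (auto simp: two_tokens_def two_tokens_configs_def product_graph_def arcless_graph_def)
  moreover have "product_goal n B1 B2 P1 =
      configs (two_tokens (product_graph n B1) (arcless_graph n)) - product_goal n B1 B2 P0"
    by simp
  ultimately have "player_partition (configs (two_tokens (product_graph n B1) (arcless_graph n)))
      (product_goal n B1 B2)"
    unfolding player_partition_def by blast
  with graphs show ?thesis
    by (simp add: product_instance_def two_trg_winning_set_def product_graph_def arcless_graph_def)
qed

lemma in_winning_set_iff:
  assumes "i < n" "j < n"
  shows "(P0, i, j) \<in> winning_set (two_tokens (product_graph n B1) (arcless_graph n))
           (product_goal n B1 B2) P0 \<longleftrightarrow> (\<exists>k<n. B1 $$ (i, k) \<and> B2 $$ (k, j))"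
    (is "?s \<in> winning_set ?G ?F P0 \<longleftrightarrow> _")
proof
  have s: "?s \<in> configs ?G" "?s \<in> controlled ?G P0"
    using assms
    by (auto simp: two_tokens_def two_tokens_configs_def product_graph_def arcless_graph_def)
  \<comment> \<open>As the second graph has no arcs, player 1 can never move and only moves of
    player 0 remain.\<close>
  have moves: "(\<sigma>, \<tau>) \<in> moves ?G \<longleftrightarrow>
      (\<exists>u v u'. \<sigma> = (P0, u, v) \<and> \<tau> = (P1, v, u') \<and> u < n \<and> u' < n \<and> v < n \<and> B1 $$ (u, u'))"
    for \<sigma> \<tau>
  proof
    assume "(\<sigma>, \<tau>) \<in> moves ?G"
    then obtain P u v u' where *: "\<sigma> = (P, u, v)" "\<tau> = (opponent P, v, u')"
      "(u, u') \<in> parcs (for_player P (product_graph n B1) (arcless_graph n))"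
      "v \<in> pverts (for_player (opponent P) (product_graph n B1) (arcless_graph n))"
      by (auto simp: two_tokens_def)
    then show "\<exists>u v u'. \<sigma> = (P0, u, v) \<and> \<tau> = (P1, v, u') \<and> u < n \<and> u' < n \<and> v < n \<and> B1 $$ (u, u')"
      by (cases P) (auto simp: product_graph_def arcless_graph_def)
  next
    assume "\<exists>u v u'. \<sigma> = (P0, u, v) \<and> \<tau> = (P1, v, u') \<and> u < n \<and> u' < n \<and> v < n \<and> B1 $$ (u, u')"
    then obtain u v u' where *: "\<sigma> = (P0, u, v)" "\<tau> = (P1, v, u')" "u < n" "u' < n" "v < n"
      "B1 $$ (u, u')" by blast
    have "\<exists>P u v u'. \<sigma> = (P, u, v) \<and> \<tau> = (opponent P, v, u') \<and>
        (u, u') \<in> parcs (for_player P (product_graph n B1) (arcless_graph n)) \<and>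
        v \<in> pverts (for_player (opponent P) (product_graph n B1) (arcless_graph n))"
      by (rule exI[of _ P0]) (use * in \<open>auto simp: product_graph_def arcless_graph_def\<close>)
    then show "(\<sigma>, \<tau>) \<in> moves ?G" by (auto simp: two_tokens_def)
  qed
  {
    assume "?s \<in> winning_set ?G ?F P0"
    then obtain s where str: "is_strategy ?G P0 s"
      and win: "\<And>\<pi>. is_play ?G \<pi> \<Longrightarrow> play_start \<pi> = ?s \<Longrightarrow> conforms ?G P0 s \<pi> \<Longrightarrow> winning_play ?F P0 \<pi>"
      by (auto simp: winning_set_def)
    show "\<exists>k<n. B1 $$ (i, k) \<and> B2 $$ (k, j)"
    proof (cases "s ?s")
      case None
      \<comment> \<open>If player 0 stops at once, the play ends in a configuration tagged
        \<open>P0\<close>, outside the goal of player 0.\<close>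
      with win[of "Fin [?s]"] s show ?thesis by auto
    next
      case (Some \<tau>)
      with str s have "(?s, \<tau>) \<in> moves ?G" by (auto simp: is_strategy_def)
      then obtain k where k: "\<tau> = (P1, j, k)" "k < n" "B1 $$ (i, k)" by (auto simp: moves)
      have "\<tau> \<in> configs ?G" "\<tau> \<notin> controlled ?G P0"
        using k assms
        by (auto simp: two_tokens_def two_tokens_configs_def product_graph_def arcless_graph_def)
      \<comment> \<open>Player 1 is free to stop, so the play that ends right after the move to
        \<open>\<tau>\<close> conforms to \<open>s\<close>.\<close>
      with win[of "Fin [?s, \<tau>]"] s Some \<open>(?s, \<tau>) \<in> moves ?G\<close> have "\<tau> \<in> ?F P0"
        by (auto simp: less_Suc_eq)
      with k show ?thesis by auto
    qed
  }
  {
    assume "\<exists>k<n. B1 $$ (i, k) \<and> B2 $$ (k, j)"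
    then obtain k where k: "k < n" "B1 $$ (i, k)" "B2 $$ (k, j)" by blast
    \<comment> \<open>The default \<open>None\<close> is harmless: player 0 decides only once,
      because no move leaves \<open>(P1, j, k)\<close>.\<close>
    define s where "s \<sigma> = (if \<sigma> = ?s then Some (P1, j, k) else None)" for \<sigma> :: "nat config"
    have str: "is_strategy ?G P0 s"
      using k assms by (auto simp: is_strategy_def s_def moves)
    have "winning_play ?F P0 \<pi>"
      if "is_play ?G \<pi>" "play_start \<pi> = ?s" "conforms ?G P0 s \<pi>" for \<pi>
    proof (cases \<pi>)
      case (Fin xs)
      then have xs: "xs ! 0 = ?s" "0 < length xs" using that by (auto simp: hd_conv_nth)
      with that Fin s have 1: "Suc 0 < length xs" "xs ! Suc 0 = (P1, j, k)"
        by (auto simp: s_def)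
      have "\<not> Suc (Suc 0) < length xs"
      proof
        assume "Suc (Suc 0) < length xs"
        with that Fin have "(xs ! Suc 0, xs ! Suc (Suc 0)) \<in> moves ?G" by simp
        with 1 show False by (simp add: moves)
      qed
      with 1 have "length xs = 2" by simp
      then have "last xs = (P1, j, k)" using 1 by (cases xs) (auto simp: last_conv_nth)
      with Fin k assms show ?thesis by simp
    next
      case (Inf f)
      with that have f: "f 0 = ?s" "\<forall>i. f i \<in> controlled ?G P0 \<longrightarrow> s (f i) = Some (f (Suc i))"
        by simp_all
      with s(2) have "s ?s = Some (f (Suc 0))" by metis
      then have "f (Suc 0) = (P1, j, k)" by (simp add: s_def)
      \<comment> \<open>An infinite play would have to leave \<open>(P1, j, k)\<close>, which is
        impossible.\<close>
      moreover from that Inf have "(f (Suc 0), f (Suc (Suc 0))) \<in> moves ?G" by simp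
      ultimately show ?thesis by (simp add: moves)
    qed
    with str s show "?s \<in> winning_set ?G ?F P0" by (auto simp: winning_set_def)
  }
qed

section \<open>Bit lists of relations in row-major order\<close>

lemma relation_bits_cong:
  "(\<And>i j. i < n \<Longrightarrow> j < m \<Longrightarrow> R i j = S i j) \<Longrightarrow> relation_bits n m R = relation_bits n m S"
  unfolding relation_bits_def by (intro arg_cong[of _ _ concat] map_cong) auto

text \<open>The first block of the solution is the \<open>P0\<close> half of the winning set of
  player 0. The other blocks are collected in \<open>zs\<close>, since an output only has to stand
  at the beginning of memory.\<close>

lemma mat_bits_product_prefix:
  assumes "B1 \<in> carrier_mat n n" "B2 \<in> carrier_mat n n"
  shows "\<exists>zs. solution (two_trg_winning_set n n) (product_instance n B1 B2) =
           mat_bits (B1 \<star> B2) @ zs"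
proof -
  have "mat_bits (B1 \<star> B2) = relation_bits n n (\<lambda>u v. (P0, u, v) \<in>
      winning_set (two_tokens (product_graph n B1) (arcless_graph n)) (product_goal n B1 B2) P0)"
    using assms by (auto simp: mat_bits_def bool_mat_mult_def in_winning_set_iff
        intro!: relation_bits_cong)
  then show ?thesis
    by (simp add: two_trg_winning_set_def product_instance_def config_set_bits_def)
qed

text \<open>Makes single cells accessible by arithmetic on addresses. In the induction, the new last
  row occupies the addresses \<open>j + n * m\<close> with \<open>j < m\<close>.\<close>

lemma relation_bits_conv_map:
  "relation_bits n m R = map (\<lambda>a. of_bool (R (a div m) (a mod m))) [0..<n * m]"
proof (induction n)
  case 0
  then show ?case by (simp add: relation_bits_def)
next
  case (Suc n)
  have "[0..<Suc n * m] = [0..<n * m] @ map (\<lambda>j. j + n * m) [0..<m]"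
    using upt_add_eq_append[of 0 "n * m" m] by (simp add: map_add_upt add.commute)
  moreover have "relation_bits (Suc n) m R = relation_bits n m R @ map (\<lambda>j. of_bool (R n j)) [0..<m]"
    by (simp add: relation_bits_def)
  ultimately show ?case using Suc by (simp add: div_add1_eq)
qed

lemma length_relation_bits [simp]: "length (relation_bits n m R) = n * m"
  by (simp add: relation_bits_conv_map)

lemma nth_relation_bits [simp]:
  "a < n * m \<Longrightarrow> relation_bits n m R ! a = of_bool (R (a div m) (a mod m))"
  by (simp add: relation_bits_conv_map)

lemma cells_of_list_append:
  "cells_of_list (xs @ ys) a =
     (if a < length xs then cells_of_list xs a else cells_of_list ys (a - length xs))"
  by (auto simp: cells_of_list_def nth_append)

section \<open>Runs of a random access machine\<close>

text \<open>Step counts are exact so that runs compose by adding them; the word bound covers all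
  intermediate states and both ends.\<close>

definition reaches :: "program \<Rightarrow> nat \<Rightarrow> nat \<Rightarrow> ram_state \<Rightarrow> ram_state \<Rightarrow> bool" where
  "reaches p w t s s' \<longleftrightarrow> ram_run p t s = s' \<and> (\<forall>i\<le>t. fits_words w (ram_run p i s))"

lemma reaches_0: "reaches p w 0 s s' \<longleftrightarrow> s = s' \<and> fits_words w s"
  by (auto simp: reaches_def ram_run_def)

lemma ram_run_add: "ram_run p (t + t') s = ram_run p t' (ram_run p t s)"
  by (simp add: ram_run_def add.commute[of t] funpow_add)

lemma reaches_trans:
  assumes "reaches p w t s s'" "reaches p w t' s' s''"
  shows "reaches p w (t + t') s s''"
proof -
  have "fits_words w (ram_run p i s)" if "i \<le> t + t'" for i
  proof (cases "i \<le> t")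
    case False
    then have "ram_run p i s = ram_run p (i - t) s'"
      using ram_run_add[of p t "i - t" s] assms by (simp add: reaches_def)
    with False that assms show ?thesis by (simp add: reaches_def)
  qed (use assms in \<open>simp add: reaches_def\<close>)
  with assms show ?thesis by (simp add: reaches_def ram_run_add)
qed

text \<open>Rule for symbolic execution. The time is decremented in the premise, so that the
  conclusion matches numerals such as 12.\<close>

lemma reaches_step:
  assumes "0 < t" "pc s < length p" "fits_words w s" "reaches p w (t - 1) (exec (p ! pc s) s) s'"
  shows "reaches p w t s s'"
proof -
  have "reaches p w 1 s (exec (p ! pc s) s)"
    using assms by (auto simp: reaches_def ram_run_def ram_step_def halted_def le_Suc_eq)
  from reaches_trans[OF this assms(4)] \<open>0 < t\<close> show ?thesis by simp
qed

lemma fits_words_mono: "fits_words w s \<Longrightarrow> w \<le> w' \<Longrightarrow> fits_words w' s"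
  unfolding fits_words_def by (meson less_le_trans one_le_numeral power_increasing)

section \<open>Running a program behind a prefix\<close>

fun relocate :: "nat \<Rightarrow> instr \<Rightarrow> instr" where
  "relocate d (Jump l) = Jump (d + l)"
| "relocate d (JumpZero r l) = JumpZero r (d + l)"
| "relocate d i = i"

lemma exec_relocate:
  "exec (relocate d i) (s\<lparr>pc := d + pc s\<rparr>) = (exec i s)\<lparr>pc := d + pc (exec i s)\<rparr>"
  by (cases i) auto

text \<open>Only jumps mention program addresses, and the halting threshold shifts together with the
  program counter, so each step is mirrored.\<close>

lemma ram_run_relocate:
  "ram_run (p0 @ map (relocate (length p0)) p) t (s\<lparr>pc := length p0 + pc s\<rparr>) =
     (ram_run p t s)\<lparr>pc := length p0 + pc (ram_run p t s)\<rparr>"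
proof (induction t)
  case 0
  then show ?case by (simp add: ram_run_def)
next
  case (Suc t)
  have "ram_step (p0 @ map (relocate (length p0)) p) (s\<lparr>pc := length p0 + pc s\<rparr>) =
     (ram_step p s)\<lparr>pc := length p0 + pc (ram_step p s)\<rparr>" for s
    by (auto simp: ram_step_def halted_def exec_relocate nth_append)
  with Suc show ?case by (simp add: ram_run_def)
qed

text \<open>The prefix must end in an initial state of \<open>p\<close>, up to the program counter,
  so scratch registers have to be cleared. From there the relocated copy mirrors the run of
  \<open>p\<close> with the same registers and memory.\<close>

lemma computes_within_prepend:
  assumes pre: "reaches (p0 @ map (relocate (length p0)) p) w t (initial_state rs xs)
                  ((initial_state rs' xs')\<lparr>pc := length p0\<rparr>)"
    and comp: "computes_within p rs' xs' (ys @ zs) t' w'" and "w' \<le> w"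
  shows "computes_within (p0 @ map (relocate (length p0)) p) rs xs ys (t + t') w"
proof -
  let ?p = "p0 @ map (relocate (length p0)) p" and ?s = "initial_state rs' xs'"
  have run: "ram_run ?p i (?s\<lparr>pc := length p0\<rparr>) =
      (ram_run p i ?s)\<lparr>pc := length p0 + pc (ram_run p i ?s)\<rparr>" for i
    using ram_run_relocate[of p0 p i ?s] by (simp add: initial_state_def)
  have fits: "fits_words w (ram_run ?p i (?s\<lparr>pc := length p0\<rparr>))" if "i \<le> t'" for i
  proof -
    have "fits_words w' (ram_run p i ?s)" using comp that by (simp add: computes_within_def)
    from fits_words_mono[OF this \<open>w' \<le> w\<close>] show ?thesis by (simp add: run fits_words_def)
  qed
  have "reaches ?p w t' (?s\<lparr>pc := length p0\<rparr>)
      ((ram_run p t' ?s)\<lparr>pc := length p0 + pc (ram_run p t' ?s)\<rparr>)"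
    using fits by (simp add: reaches_def run)
  from reaches_trans[OF pre this]
  have final: "ram_run ?p (t + t') (initial_state rs xs) =
        (ram_run p t' ?s)\<lparr>pc := length p0 + pc (ram_run p t' ?s)\<rparr>"
    and fits': "\<forall>i\<le>t + t'. fits_words w (ram_run ?p i (initial_state rs xs))"
    unfolding reaches_def by blast+
  from comp have "length p \<le> pc (ram_run p t' ?s)"
    and "map (mem (ram_run p t' ?s)) [0..<length (ys @ zs)] = ys @ zs"
    unfolding computes_within_def halted_def by blast+
  \<comment> \<open>Cuts the output down to its first part \<open>ys\<close>.\<close>
  moreover from this(2) have "map (mem (ram_run p t' ?s)) [0..<length ys] = ys"
    using upt_add_eq_append[of 0 "length ys" "length zs"] by simp
  ultimately show ?thesis
    using fits' by (simp add: computes_within_def final halted_def)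
qed

section \<open>Moving and transposing the second matrix\<close>

text \<open>
  Registers 2 to 6 hold \<open>n\<^sup>2\<close>, \<open>3n\<^sup>2\<close>, the loop counter, 1 and the current address;
  register 9 is never written, hence zero.
\<close>

definition transpose_program :: program where
  "transpose_program =
    [Arith OpMul 2 0 0,
     Arith OpAdd 3 2 2,
     Arith OpAdd 3 3 2,
     Arith OpAdd 4 2 5,
     Const 5 1,
     JumpZero 4 17,
     Arith OpSub 4 4 5,
     Arith OpAdd 6 2 4,
     Load 7 6,
     Store 6 9,
     Arith OpMod 6 4 0,
     Arith OpMul 6 6 0,
     Arith OpAdd 6 6 3,
     Arith OpDiv 8 4 0,
     Arith OpAdd 6 6 8,
     Store 6 7,
     Jump 5,
     Const 2 0,
     Const 3 0,
     Const 5 0,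
     Const 6 0,
     Const 7 0,
     Const 8 0]"

lemma length_transpose_program: "length transpose_program = 23"
  by (simp add: transpose_program_def)

text \<open>Lookup table for symbolic execution, with \<open>Suc 0\<close> in the simplifier's
  normal form. Addresses 0 to 4 set up constants and counter, where register 5 is still zero at
  address 3 and the sum is a mere copy. Addresses 5 to 16 are the loop, and the rest clears
  registers for the next program.\<close>

lemma nth_transpose_program:
  "(transpose_program @ p) ! 0 = Arith OpMul 2 0 0"
  "(transpose_program @ p) ! Suc 0 = Arith OpAdd 3 2 2"
  "(transpose_program @ p) ! 2 = Arith OpAdd 3 3 2"
  "(transpose_program @ p) ! 3 = Arith OpAdd 4 2 5"
  "(transpose_program @ p) ! 4 = Const 5 1"
  "(transpose_program @ p) ! 5 = JumpZero 4 17"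
  "(transpose_program @ p) ! 6 = Arith OpSub 4 4 5"
  "(transpose_program @ p) ! 7 = Arith OpAdd 6 2 4"
  "(transpose_program @ p) ! 8 = Load 7 6"
  "(transpose_program @ p) ! 9 = Store 6 9"
  "(transpose_program @ p) ! 10 = Arith OpMod 6 4 0"
  "(transpose_program @ p) ! 11 = Arith OpMul 6 6 0"
  "(transpose_program @ p) ! 12 = Arith OpAdd 6 6 3"
  "(transpose_program @ p) ! 13 = Arith OpDiv 8 4 0"
  "(transpose_program @ p) ! 14 = Arith OpAdd 6 6 8"
  "(transpose_program @ p) ! 15 = Store 6 7"
  "(transpose_program @ p) ! 16 = Jump 5"
  "(transpose_program @ p) ! 17 = Const 2 0"
  "(transpose_program @ p) ! 18 = Const 3 0"
  "(transpose_program @ p) ! 19 = Const 5 0"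
  "(transpose_program @ p) ! 20 = Const 6 0"
  "(transpose_program @ p) ! 21 = Const 7 0"
  "(transpose_program @ p) ! 22 = Const 8 0"
  by (simp_all add: transpose_program_def nth_append)

lemma fits_words_make:
  "fits_words w \<lparr>pc = k, reg = R, mem = M\<rparr> \<longleftrightarrow> (\<forall>r. R r < 2 ^ w) \<and> (\<forall>a. M a < 2 ^ w)"
  by (simp add: fits_words_def)

text \<open>In row-major order, transposition exchanges the two base-\<open>n\<close> digits of an
  address. The first two equations read off the exchanged digits, so exchanging twice is the
  identity.\<close>

lemma transposed_index:
  fixes c n :: nat
  assumes "c < n * n"
  shows "(c mod n * n + c div n) div n = c mod n" "(c mod n * n + c div n) mod n = c div n"
    "c mod n * n + c div n < n * n"
proof -
  have n: "0 < n" "c div n < n" using assms by (auto simp: less_mult_imp_div_less intro: gr0I)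
  then show "(c mod n * n + c div n) div n = c mod n" "(c mod n * n + c div n) mod n = c div n"
    by simp_all
  then show "c mod n * n + c div n < n * n"
    using n by (metis div_less_iff_less_mult mod_less_divisor)
qed

text \<open>One pass through addresses 5 to 16. The counter is decremented before use, so the value
  \<open>Suc c\<close> treats entry \<open>c\<close>; \<open>d\<close> adds its summands in the
  order of the program.\<close>

lemma transpose_iteration:
  fixes n c w :: nat and R M :: "nat \<Rightarrow> nat"
  defines "d \<equiv> c mod n * n + 3 * (n * n) + c div n"
  assumes w: "4 * (n * n) + 1 < 2 ^ w" and c: "c < n * n"
    and fits: "\<forall>r. R r < 2 ^ w" "\<forall>a. M a < 2 ^ w"
    and R: "R 0 = n" "R 2 = n * n" "R 3 = 3 * (n * n)" "R 4 = Suc c" "R 5 = 1" "R 9 = 0"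
  shows "reaches (transpose_program @ p) w 12 \<lparr>pc = 5, reg = R, mem = M\<rparr>
           \<lparr>pc = 5, reg = R(4 := c, 6 := d, 7 := M (n * n + c), 8 := c div n),
            mem = M(n * n + c := 0, d := M (n * n + c))\<rparr>"
proof -
  have d: "d < 4 * (n * n)" using transposed_index(3)[OF c] by (simp add: d_def)
  \<comment> \<open>Bounds for every value written during the pass, which settle the word-size
    conditions.\<close>
  have b: "c div n < 2 ^ w" "c mod n < 2 ^ w" "c < 2 ^ w" "c mod n * n < 2 ^ w" "n * n + c < 2 ^ w"
    "c mod n * n + 3 * (n * n) < 2 ^ w" "c mod n * n + 3 * (n * n) + c div n < 2 ^ w" "0 < (2::nat) ^ w" "M (n * n + c) < 2 ^ w"
    using d w c fits div_le_dividend[of c n] mod_less_eq_dividend[of c n]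
    unfolding d_def by (auto simp del: mod_less_eq_dividend div_le_dividend)
  show ?thesis
    \<comment> \<open>Each repetition executes one instruction, until the time is used up.\<close>
    apply (rule reaches_step, simp, simp add: length_transpose_program,
        simp add: fits_words_make fits b, simp add: nth_transpose_program R b)+
    apply (simp add: reaches_0 fits_words_make fits b d_def fun_eq_iff)
    done
qed

text \<open>
  The memory when \<open>c\<close> cells of the second matrix are still in place; \<open>A\<close> and \<open>B\<close> are the
  cells of the two matrices.
\<close>

definition partly_moved :: "nat \<Rightarrow> (nat \<Rightarrow> nat) \<Rightarrow> (nat \<Rightarrow> nat) \<Rightarrow> nat \<Rightarrow> nat \<Rightarrow> nat" where
  "partly_moved n A B c a =
     (if a < n * n then A a
      else if a < 2 * (n * n) then (if a - n * n < c then B (a - n * n) else 0)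
      else if 3 * (n * n) \<le> a \<and> a < 4 * (n * n) then
        (let e = (a - 3 * (n * n)) mod n * n + (a - 3 * (n * n)) div n in if c \<le> e then B e else 0)
      else 0)"

text \<open>The loop invariant is preserved when the counter falls from \<open>Suc c\<close> to
  \<open>c\<close>. The delicate point is that no target cell other than \<open>d\<close> waits for
  entry \<open>c\<close>.\<close>

lemma partly_moved_step:
  fixes n c :: nat
  defines "d \<equiv> c mod n * n + 3 * (n * n) + c div n"
  assumes c: "c < n * n"
  shows "(partly_moved n A B (Suc c))(n * n + c := 0, d := B c) = partly_moved n A B c"
proof
  fix a
  let ?t = "\<lambda>e. e mod n * n + e div n"
  have d: "d - 3 * (n * n) = ?t c" "3 * (n * n) \<le> d" "d < 4 * (n * n)"
    using transposed_index(3)[OF c] by (auto simp: d_def)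
  have tt: "?t (?t e) = e" if "e < n * n" for e
    using transposed_index[OF that] by simp
  consider "a = d" | "a = n * n + c" "a \<noteq> d" | "a \<noteq> d" "a \<noteq> n * n + c" "a < 3 * (n * n)"
    | "a \<noteq> d" "3 * (n * n) \<le> a" "a < 4 * (n * n)" | "a \<noteq> d" "4 * (n * n) \<le> a"
    by linarith
  then show "((partly_moved n A B (Suc c))(n * n + c := 0, d := B c)) a = partly_moved n A B c a"
  proof cases
    case 1
    then show ?thesis using d tt[OF c] c by (simp add: partly_moved_def Let_def)
  next
    case 4
    let ?e = "?t (a - 3 * (n * n))"
    \<comment> \<open>Since the digit exchange is its own inverse, a target cell with source
      \<open>c\<close> could only be \<open>d\<close>.\<close>
    have "?e \<noteq> c"
    proof
      assume "?e = c"
      then have "a - 3 * (n * n) = ?t c" using tt[of "a - 3 * (n * n)"] 4 by fastforce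
      with d 4 show False by linarith
    qed
    then have "Suc c \<le> ?e \<longleftrightarrow> c \<le> ?e" by linarith
    then show ?thesis using 4 c by (simp add: partly_moved_def Let_def)
  qed (use c in \<open>auto simp: partly_moved_def less_Suc_eq\<close>)
qed

lemma partly_moved_bounded:
  "\<forall>a. A a < b \<Longrightarrow> \<forall>a. B a < b \<Longrightarrow> partly_moved n A B c a < b" for b :: nat
proof -
  assume b: "\<forall>a. A a < b" "\<forall>a. B a < b"
  then have "0 < b" by (cases b) auto
  with b show ?thesis by (simp add: partly_moved_def Let_def)
qed

text \<open>The run stops at the loop head with counter 0, just before the exit jump. Registers 4,
  6, 7 and 8 are the only ones written in the loop; the others keep the constants needed in each
  pass.\<close>

lemma transpose_loop:
  fixes n c w :: nat and A B R :: "nat \<Rightarrow> nat"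
  assumes w: "4 * (n * n) + 1 < 2 ^ w" and c: "c \<le> n * n"
    and fits: "\<forall>r. R r < 2 ^ w" "\<forall>a. A a < 2 ^ w" "\<forall>a. B a < 2 ^ w"
    and R: "R 0 = n" "R 2 = n * n" "R 3 = 3 * (n * n)" "R 4 = c" "R 5 = 1" "R 9 = 0"
  shows "\<exists>R'. reaches (transpose_program @ p) w (12 * c)
             \<lparr>pc = 5, reg = R, mem = partly_moved n A B c\<rparr>
             \<lparr>pc = 5, reg = R', mem = partly_moved n A B 0\<rparr> \<and>
           R' 4 = 0 \<and> (\<forall>r. r \<notin> {4, 6, 7, 8} \<longrightarrow> R' r = R r)"
  using c fits(1) R
proof (induction c arbitrary: R)
  case 0
  then have "reaches (transpose_program @ p) w (12 * 0)
      \<lparr>pc = 5, reg = R, mem = partly_moved n A B 0\<rparr>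
      \<lparr>pc = 5, reg = R, mem = partly_moved n A B 0\<rparr>"
    using partly_moved_bounded[OF fits(2,3)] by (simp add: reaches_0 fits_words_make)
  with 0 show ?case by blast
next
  case (Suc c)
  let ?M = "partly_moved n A B (Suc c)"
  let ?d = "c mod n * n + 3 * (n * n) + c div n"
  let ?R = "R(4 := c, 6 := ?d, 7 := B c, 8 := c div n)"
  have c: "c < n * n" using Suc.prems by simp
  then have M: "?M (n * n + c) = B c" by (simp add: partly_moved_def)
  have step: "reaches (transpose_program @ p) w 12 \<lparr>pc = 5, reg = R, mem = ?M\<rparr>
      \<lparr>pc = 5, reg = ?R, mem = partly_moved n A B c\<rparr>"
    using transpose_iteration[OF w c, of R ?M p] Suc.prems partly_moved_bounded[OF fits(2,3)]
    by (simp add: M partly_moved_step[OF c])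
  \<comment> \<open>The bound on the new registers is read off from the end of the run just
    established.\<close>
  then have "fits_words w \<lparr>pc = 5, reg = ?R, mem = partly_moved n A B c\<rparr>"
    by (auto simp: reaches_def)
  then have bounded: "\<forall>r. ?R r < 2 ^ w"
    by (rule fits_words_make[THEN iffD1, THEN conjunct1])
  have regs: "?R 0 = n" "?R 2 = n * n" "?R 3 = 3 * (n * n)" "?R 4 = c" "?R 5 = 1" "?R 9 = 0"
    using Suc.prems by simp_all
  from Suc.IH[OF less_imp_le[OF c] bounded regs] obtain R' where R':
    "reaches (transpose_program @ p) w (12 * c)
       \<lparr>pc = 5, reg = ?R, mem = partly_moved n A B c\<rparr>
       \<lparr>pc = 5, reg = R', mem = partly_moved n A B 0\<rparr>"
    "R' 4 = 0" "\<forall>r. r \<notin> {4, 6, 7, 8} \<longrightarrow> R' r = ?R r"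
    by blast
  have "reaches (transpose_program @ p) w (12 * Suc c) \<lparr>pc = 5, reg = R, mem = ?M\<rparr>
      \<lparr>pc = 5, reg = R', mem = partly_moved n A B 0\<rparr>"
    using reaches_trans[OF step R'(1)] by simp
  with R'(2,3) show ?case by auto
qed

text \<open>Each target cell has a source index below \<open>n * n\<close>, so with counter
  \<open>n * n\<close> none is filled and the second matrix is intact.\<close>

lemma partly_moved_initial:
  assumes "B1 \<in> carrier_mat n n" "B2 \<in> carrier_mat n n"
  shows "cells_of_list (mat_bits B1 @ mat_bits B2) =
           partly_moved n (cells_of_list (mat_bits B1)) (cells_of_list (mat_bits B2)) (n * n)"
proof
  fix a
  let ?e = "(a - 3 * (n * n)) mod n * n + (a - 3 * (n * n)) div n"
  have l: "length (mat_bits B1) = n * n" "length (mat_bits B2) = n * n"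
    using assms by (simp_all add: mat_bits_def)
  have "?e < n * n" if "3 * (n * n) \<le> a" "a < 4 * (n * n)"
    using that by (intro transposed_index) simp
  then have e: "\<not> n * n \<le> ?e" if "3 * (n * n) \<le> a" "a < 4 * (n * n)"
    using that by simp
  have out: "cells_of_list (mat_bits B2) (a - n * n) = 0" if "2 * (n * n) \<le> a"
  proof -
    from that have "\<not> a - n * n < n * n" by linarith
    then show ?thesis by (simp add: cells_of_list_def l)
  qed
  consider "a < n * n" | "n * n \<le> a" "a < 2 * (n * n)" | "2 * (n * n) \<le> a" by linarith
  then show "cells_of_list (mat_bits B1 @ mat_bits B2) a =
      partly_moved n (cells_of_list (mat_bits B1)) (cells_of_list (mat_bits B2)) (n * n) a"
  proof cases
    case 2
    then have "a - n * n < n * n" by linarith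
    with 2 show ?thesis by (simp add: cells_of_list_append l partly_moved_def)
  next
    case 3
    then have "\<not> a < n * n" "\<not> a < 2 * (n * n)" by linarith+
    with e have "partly_moved n (cells_of_list (mat_bits B1)) (cells_of_list (mat_bits B2)) (n * n) a = 0"
      unfolding partly_moved_def Let_def by meson
    with 3 out show ?thesis by (simp add: cells_of_list_append l)
  qed (simp add: cells_of_list_append l partly_moved_def)
qed

text \<open>With counter 0 the two middle blocks are zero. They encode the arcless graph and the
  \<open>P0\<close> half of the goal; the transposed matrix behind them encodes the
  \<open>P1\<close> half.\<close>

lemma partly_moved_final:
  assumes "B1 \<in> carrier_mat n n" "B2 \<in> carrier_mat n n"
  shows "cells_of_list (input (two_trg_winning_set n n) (product_instance n B1 B2)) =
           partly_moved n (cells_of_list (mat_bits B1)) (cells_of_list (mat_bits B2)) 0"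
proof
  fix a
  let ?z = "relation_bits n n (\<lambda>_ _. False)"
  have "relation_bits n n (\<lambda>u v. (u, v) \<in> parcs (product_graph n B1)) = mat_bits B1"
    using assms by (auto simp: mat_bits_def product_graph_def intro!: relation_bits_cong)
  moreover have "relation_bits n n (\<lambda>u v. (P1, u, v) \<in> product_goal n B1 B2 P0) =
      relation_bits n n (\<lambda>u v. B2 $$ (v, u))"
    by (auto intro!: relation_bits_cong)
  ultimately have input: "input (two_trg_winning_set n n) (product_instance n B1 B2) =
      mat_bits B1 @ ?z @ ?z @ relation_bits n n (\<lambda>u v. B2 $$ (v, u))"
    by (simp add: two_trg_winning_set_def product_instance_def graph_bits_def config_set_bits_def
        arcless_graph_def)
  have z: "cells_of_list ?z b = 0" for b by (simp add: cells_of_list_def)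
  have l: "length (mat_bits B1) = n * n" using assms by (simp add: mat_bits_def)
  have transposed: "cells_of_list (relation_bits n n (\<lambda>u v. B2 $$ (v, u))) b =
      cells_of_list (mat_bits B2) (b mod n * n + b div n)" if "b < n * n" for b
    using assms transposed_index[OF that] that by (simp add: cells_of_list_def mat_bits_def)
  consider "a < n * n" | "n * n \<le> a" "a < 3 * (n * n)" | "3 * (n * n) \<le> a" "a < 4 * (n * n)"
    | "4 * (n * n) \<le> a" by linarith
  then show "cells_of_list (input (two_trg_winning_set n n) (product_instance n B1 B2)) a =
      partly_moved n (cells_of_list (mat_bits B1)) (cells_of_list (mat_bits B2)) 0 a"
  proof cases
    case 3
    then have "\<not> a < n * n" "\<not> a - n * n < n * n" "\<not> a - n * n - n * n < n * n"
      "a - n * n - n * n - n * n = a - 3 * (n * n)" "a - 3 * (n * n) < n * n" by linarith+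
    with 3 show ?thesis unfolding input
      by (simp add: cells_of_list_append l partly_moved_def transposed Let_def del: diff_diff_left)
  next
    case 4
    then have "n * n \<le> a - n * n - n * n - n * n" by linarith
    with 4 show ?thesis unfolding input
      by (simp add: cells_of_list_append l partly_moved_def cells_of_list_def)
  qed (simp_all add: input cells_of_list_append l z partly_moved_def)
qed

text \<open>The time is 5 for the setup, 12 for each of the \<open>n * n\<close> entries, and 7 for
  the exit jump and the six resets.\<close>

lemma transpose_program_reaches:
  assumes w: "4 * (n * n) + 1 < 2 ^ w"
    and B: "B1 \<in> carrier_mat n n" "B2 \<in> carrier_mat n n"
  shows "reaches (transpose_program @ p) w (12 * (n * n) + 12)
           (initial_state [n, n, n] (mat_bits B1 @ mat_bits B2))
           ((initial_state [n, n] (input (two_trg_winning_set n n) (product_instance n B1 B2)))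
             \<lparr>pc := length transpose_program\<rparr>)"
proof -
  let ?p = "transpose_program @ p"
  let ?A = "cells_of_list (mat_bits B1)" and ?B = "cells_of_list (mat_bits B2)"
  let ?N = "cells_of_list [n, n, n]"
  let ?M = "partly_moved n ?A ?B"
  let ?R = "?N(2 := n * n, 3 := 3 * (n * n), 4 := n * n, 5 := 1)"
  have b: "n < 2 ^ w" "n * n < 2 ^ w" "n * n + n * n < 2 ^ w" "3 * (n * n) < 2 ^ w"
    "Suc 0 < 2 ^ w" "0 < (2::nat) ^ w"
    using w le_square[of n] by linarith+
  have N: "?N r = (if r < 3 then n else 0)" for r
    by (auto simp: cells_of_list_def less_Suc_eq numeral_3_eq_3)
  have bits: "\<forall>a. cells_of_list (mat_bits C) a < 2 ^ w" for C
    using b by (auto simp: cells_of_list_def mat_bits_def)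
  have fits: "\<forall>r. ?N r < 2 ^ w" "\<forall>a. ?M c a < 2 ^ w" for c
    using b bits by (auto simp: N intro!: partly_moved_bounded)
  have sum3: "n * n + n * n + n * n = 3 * (n * n)" by simp
  have 1: "reaches ?p w 5 (initial_state [n, n, n] (mat_bits B1 @ mat_bits B2))
      \<lparr>pc = 5, reg = ?R, mem = ?M (n * n)\<rparr>"
    unfolding initial_state_def partly_moved_initial[OF B]
        \<comment> \<open>\<open>numeral_2_eq_2[symmetric]\<close> turns the address
          \<open>Suc (Suc 0)\<close> into the numeral of the lookup table.\<close>
        apply (rule reaches_step, simp, simp add: length_transpose_program,
        simp add: fits_words_make fits b, simp add: nth_transpose_program N sum3 numeral_2_eq_2[symmetric])+
    apply (simp add: reaches_0 fits_words_make fits b)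
    done
  have "fits_words w \<lparr>pc = 5, reg = ?R, mem = ?M (n * n)\<rparr>"
    using 1 by (auto simp: reaches_def)
  then have bounded: "\<forall>r. ?R r < 2 ^ w"
    by (rule fits_words_make[THEN iffD1, THEN conjunct1])
  have regs: "?R 0 = n" "?R 2 = n * n" "?R 3 = 3 * (n * n)" "?R 4 = n * n" "?R 5 = 1" "?R 9 = 0"
    by (simp_all add: N)
  from transpose_loop[OF w order_refl bounded bits[of B1] bits[of B2] regs, of p]
  obtain R' where
    2: "reaches ?p w (12 * (n * n)) \<lparr>pc = 5, reg = ?R, mem = ?M (n * n)\<rparr>
          \<lparr>pc = 5, reg = R', mem = ?M 0\<rparr>"
    and R': "R' 4 = 0" "\<forall>r. r \<notin> {4, 6, 7, 8} \<longrightarrow> R' r = ?R r"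
    by blast
  then have fits': "\<forall>r. R' r < 2 ^ w" by (auto simp: reaches_def fits_words_def)
  \<comment> \<open>Register 4 needs no reset, being 0 at loop exit. Register 2 does: only two size
    parameters are passed on.\<close>
  have "(R'(2 := 0, 3 := 0, 5 := 0, 6 := 0, 7 := 0, 8 := 0)) r = cells_of_list [n, n] r" for r
    using R' by (cases "r = 4") (auto simp: N cells_of_list_def less_Suc_eq)
  then have R'_reset: "R'(2 := 0, 3 := 0, 5 := 0, 6 := 0, 7 := 0, 8 := 0) = cells_of_list [n, n]"
    by (rule ext)
  from fits' b have final_fits: "\<forall>r. cells_of_list [n, n] r < 2 ^ w"
    unfolding R'_reset[symmetric] by simp
  have 3: "reaches ?p w 7 \<lparr>pc = 5, reg = R', mem = ?M 0\<rparr>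
      ((initial_state [n, n] (input (two_trg_winning_set n n) (product_instance n B1 B2)))
             \<lparr>pc := length transpose_program\<rparr>)"
    unfolding initial_state_def partly_moved_final[OF B]
    apply -
    apply (rule reaches_step, simp, simp add: length_transpose_program,
        simp add: fits_words_make fits fits' b, simp add: nth_transpose_program R')+
    apply (simp add: reaches_0 fits_words_make fits fits' b length_transpose_program R'_reset final_fits)
    done
  from reaches_trans[OF 1 reaches_trans[OF 2 3]] show ?thesis by (simp add: algebra_simps)
qed

section \<open>Complexity\<close>

text \<open>The transposition uses addresses below \<open>4 * (n * n)\<close>. Twice
  \<open>L n\<close> bits cover the square of \<open>n + 1\<close>, and three more bits give a
  factor 8; \<open>n + 1\<close> keeps the argument of the logarithm positive at 0.\<close>

lemma exists_logarithmic_word_size: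
  "\<exists>K :: nat \<Rightarrow> nat. (\<forall>n. 4 * (n * n) + 1 < 2 ^ K n) \<and> (\<lambda>n. real (K n)) \<in> O(\<lambda>n. ln (real n))"
proof (intro exI conjI allI)
  define L where "L n = nat \<lceil>log 2 (real (n + 1))\<rceil>" for n :: nat
  show "4 * (n * n) + 1 < 2 ^ (3 + 2 * L n)" for n
  proof -
    have "log 2 (real (n + 1)) \<le> real (L n)" unfolding L_def by (rule real_nat_ceiling_ge)
    then have "real (n + 1) \<le> 2 powr real (L n)" by (simp add: log_le_iff)
    moreover have "2 powr real (L n) = real (2 ^ L n)" by (simp add: powr_realpow)
    ultimately have "real (n + 1) \<le> real (2 ^ L n)" by linarith
    then have "n + 1 \<le> 2 ^ L n" by (simp only: of_nat_le_iff)
    from mult_mono[OF this this] have "(n + 1) * (n + 1) \<le> 2 ^ L n * 2 ^ L n" by simp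
    moreover have "4 * (n * n) + 1 < 8 * ((n + 1) * (n + 1))" by simp
    moreover have "(2 :: nat) ^ (3 + 2 * L n) = 8 * (2 ^ L n * 2 ^ L n)"
      by (simp only: power_add mult_2) simp
    ultimately show ?thesis by linarith
  qed
  \<comment> \<open>From \<open>n + 1 \<le> n * n\<close> follows
    \<open>L n \<le> 2 * log 2 n + 1\<close>, and \<open>1 \<le> log 2 n\<close> then bounds
    \<open>5 + 4 * log 2 n\<close> by \<open>9 * log 2 n\<close>.\<close>
  have "real (3 + 2 * L n) \<le> 9 / ln 2 * ln (real n)" if n: "n \<ge> 2" for n :: nat
  proof -
    have "n + 1 \<le> 2 * n" using n by simp
    also have "\<dots> \<le> n * n" using n by (rule mult_le_mono1)
    finally have "real (n + 1) \<le> real (n * n)" by (simp only: of_nat_le_iff)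
    then have "real (n + 1) \<le> real n * real n" by simp
    then have "log 2 (real (n + 1)) \<le> log 2 (real n * real n)"
      by (intro log_mono) auto
    also have "\<dots> = 2 * log 2 (real n)" using n by (simp add: log_mult)
    finally have "log 2 (real (n + 1)) \<le> 2 * log 2 (real n)" .
    moreover have "0 \<le> log 2 (real (n + 1))" by (rule zero_le_log_cancel_iff[THEN iffD2]) simp_all
    then have "real (L n) = of_int \<lceil>log 2 (real (n + 1))\<rceil>"
      unfolding L_def by (intro of_nat_nat) linarith
    then have "real (L n) \<le> log 2 (real (n + 1)) + 1"
      using of_int_ceiling_le_add_one[of "log 2 (real (n + 1))"] by linarith
    moreover have "1 \<le> log 2 (real n)" using n by (simp add: le_log_iff)
    ultimately have "real (3 + 2 * L n) \<le> 9 * log 2 (real n)" by simp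
    then show ?thesis by (simp add: log_def)
  qed
  then show "(\<lambda>n. real (3 + 2 * L n)) \<in> O(\<lambda>n. ln (real n))"
    by (intro bigoI[of _ "9 / ln 2"] eventually_sequentiallyI[of 2]) auto
qed

theorem theorem11:
  fixes \<alpha> :: real
  assumes "\<alpha> \<ge> 2"
    and "solvable_in_time (\<lambda>n. two_trg_winning_set n n) (\<lambda>n. real n powr \<alpha>)"
  shows "solvable_in_time (\<lambda>n. boolean_matrix_multiplication n n n) (\<lambda>n. real n powr \<alpha>)"
proof -
  from assms(2) obtain p :: program and T W :: "nat \<Rightarrow> nat" where
    T: "(\<lambda>n. real (T n)) \<in> O(\<lambda>n. real n powr \<alpha>)" and
    W: "(\<lambda>n. real (W n)) \<in> O(\<lambda>n. ln (real n))" and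
    p: "\<And>n x. x \<in> instances (two_trg_winning_set n n) \<Longrightarrow>
      computes_within p (size_params (two_trg_winning_set n n)) (input (two_trg_winning_set n n) x)
        (solution (two_trg_winning_set n n) x) (T n) (W n)"
    unfolding solvable_in_time_def by blast
  obtain K :: "nat \<Rightarrow> nat" where
    K: "\<And>n. 4 * (n * n) + 1 < 2 ^ K n" "(\<lambda>n. real (K n)) \<in> O(\<lambda>n. ln (real n))"
    using exists_logarithmic_word_size by blast
  let ?p = "transpose_program @ map (relocate (length transpose_program)) p"
  \<comment> \<open>The sum of the word sizes dominates both the one for the transposition and the
    one for \<open>p\<close>.\<close>
  let ?T = "\<lambda>n. 12 * (n * n) + 12 + T n" and ?W = "\<lambda>n. K n + W n"
  \<comment> \<open>Here \<open>\<alpha> \<ge> 2\<close> absorbs the quadratic preprocessing: for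
    positive \<open>n\<close>, both \<open>n * n\<close> and 1 are at most
    \<open>real n powr \<alpha>\<close>.\<close>
  have "real (12 * (n * n) + 12) \<le> 24 * (real n powr \<alpha>)" if n: "n \<ge> 1" for n :: nat
  proof -
    have "real n * real n = real n powr 2" using n by (simp add: powr_numeral power2_eq_square)
    also have "\<dots> \<le> real n powr \<alpha>" using n assms(1) by (intro powr_mono) auto
    finally have "real n * real n \<le> real n powr \<alpha>" .
    moreover have "1 \<le> real n powr \<alpha>" using n assms(1) by (intro ge_one_powr_ge_zero) auto
    ultimately show ?thesis by simp
  qed
  then have "(\<lambda>n. real (12 * (n * n) + 12)) \<in> O(\<lambda>n. real n powr \<alpha>)"
    by (intro bigoI[of _ 24] eventually_sequentiallyI[of 1]) auto
  from sum_in_bigo(1)[OF this T] have T': "(\<lambda>n. real (?T n)) \<in> O(\<lambda>n. real n powr \<alpha>)"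
    by simp
  from sum_in_bigo(1)[OF K(2) W] have W': "(\<lambda>n. real (?W n)) \<in> O(\<lambda>n. ln (real n))"
    by simp
  have "computes_within ?p (size_params (boolean_matrix_multiplication n n n))
      (input (boolean_matrix_multiplication n n n) x)
      (solution (boolean_matrix_multiplication n n n) x) (?T n) (?W n)"
    if "x \<in> instances (boolean_matrix_multiplication n n n)" for n x
  proof -
    from that obtain B1 B2 where x: "x = (B1, B2)" and
      B: "B1 \<in> carrier_mat n n" "B2 \<in> carrier_mat n n"
      by (auto simp: boolean_matrix_multiplication_def)
    from mat_bits_product_prefix[OF B] obtain zs where
      "solution (two_trg_winning_set n n) (product_instance n B1 B2) = mat_bits (B1 \<star> B2) @ zs"
      by blast
    with p[OF product_instance_in_instances, of n B1 B2] have
      "computes_within p [n, n] (input (two_trg_winning_set n n) (product_instance n B1 B2))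
         (mat_bits (B1 \<star> B2) @ zs) (T n) (W n)"
      by (simp add: two_trg_winning_set_def)
    moreover have "2 ^ K n \<le> (2 :: nat) ^ ?W n" by (rule power_increasing) auto
    with K(1)[of n] have "4 * (n * n) + 1 < 2 ^ ?W n" by linarith
    ultimately have "computes_within ?p [n, n, n] (mat_bits B1 @ mat_bits B2)
        (mat_bits (B1 \<star> B2)) (?T n) (?W n)"
      using transpose_program_reaches[OF _ B] by (intro computes_within_prepend) auto
    then show ?thesis by (simp add: x boolean_matrix_multiplication_def)
  qed
  with T' W' show ?thesis
    unfolding solvable_in_time_def by (intro exI[of _ ?p] exI[of _ ?T] exI[of _ ?W]) blast
qed

end
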